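(* Suppose $\varphi:\mathcal M\to\mathcal M'$ is a monoid homomorphism, where the monoid $\mathcal M'$ is totally ordered. Viewing $\mathcal M'$ as a bipotent semiring$^\dagger$ (with addition $a+b=\max\{a,b\}$), there is a natural homomorphism of semirings$^\dagger$ $\widehat\varphi:\overline{[\mathcal M]}\to\mathcal M'$ given by $$\widehat\varphi\Big(\sum_{a\in S}a\Big)=\sum_{a\in S}\varphi(a),$$ satisfying the universal property that $\varphi$ factors as $$\varphi:\ \mathcal M\longrightarrow\overline{[\mathcal M]}\xrightarrow{\ \widehat\varphi\ }\mathcal M'.$$
   Context: All monoids are commutative. A semiring$^\dagger$ is a semiring with multiplicative unit but not necessarily with a zero element; homomorphisms preserve $+$, $\cdot$ and the unit. A semiring$^\dagger$ is bipotent if $a+b\in\{a,b\}$ for all $a,b$. A totally ordered monoid is a monoid with a total order such that $b\le c$ implies $ab\le ac$; such a monoid becomes a bipotent semiring$^\dagger$ with its given multiplication and with $a+b:=\max\{a,b\}$. $\mathbb N$ denotes the positive natural numbers. For a monoid $\mathcal M$, $[\mathcal M]$ is the semiring$^\dagger$ of formal sums $\sum_{a\in S}a$ of distinct elements of $\mathcal M$ ($S\subset\mathcal M$ a finite nonempty subset), with addition $\sum_{a\in S}a+\sum_{a\in S'}a=\sum_{a\in S\cup S'}a$ and with multiplication extending that of $\mathcal M$ distributively (equivalently, the monoid semiring$^\dagger$ $\mathbb N[\mathcal M]$ modulo the congruence generated by $x+x\equiv x$). The Frobenius monoid semiring$^\dagger$ $\overline{[\mathcal M]}$ is the quotient of $[\mathcal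 M]$ by the semiring$^\dagger$ congruence generated by the relations $$\Big(\sum_{a\in S}a\Big)^m+c\equiv\Big(\sum_{a\in S}a^m\Big)+c,\qquad \Big(\sum_{a\in S}a\Big)^m c\equiv\sum_{a\in S}a^m c,$$ for all finite (nonempty) $S\subset\mathcal M$, all $m\in\mathbb N$ and all $c\in[\mathcal M]$. The class of $\sum_{a\in S}a$ in $\overline{[\mathcal M]}$ is denoted by the same symbol, and the map $\mathcal M\to\overline{[\mathcal M]}$ sends $a$ to the class of $a$. *)

theory Defs
  imports Main
begin

text \<open>
  Commutative monoids are types of class \<^class>\<open>comm_monoid_mult\<close>.  A semiring with a multiplicative
  unit but not necessarily a zero (written semiring with a dagger) is captured by the following
  class; its multiplication is commutative, as all monoids are.
\<close>

class semiring_dagger = comm_semiring + comm_monoid_mult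

class bipotent_semiring_dagger = semiring_dagger +
  assumes bipotent: "a + b = a \<or> a + b = b"

class totally_ordered_monoid = comm_monoid_mult + linorder +
  assumes monoid_mult_left_mono: "b \<le> c \<Longrightarrow> a * b \<le> a * c"

definition monoid_hom :: "('a::comm_monoid_mult \<Rightarrow> 'b::comm_monoid_mult) \<Rightarrow> bool" where
  "monoid_hom f \<longleftrightarrow> f 1 = 1 \<and> (\<forall>x y. f (x * y) = f x * f y)"

definition semiring_dagger_hom :: "('a::semiring_dagger \<Rightarrow> 'b::semiring_dagger) \<Rightarrow> bool" where
  "semiring_dagger_hom f \<longleftrightarrow> monoid_hom f \<and> (\<forall>x y. f (x + y) = f x + f y)"

text \<open>
  Finite nonempty sums.  The library constant \<^const>\<open>sum\<close> requires a zero, so one is adjoined as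
  \<^const>\<open>None\<close>.  The value is meaningful only for finite nonempty index sets.
\<close>

definition nsum :: "('i \<Rightarrow> 'a::ab_semigroup_add) \<Rightarrow> 'i set \<Rightarrow> 'a" where
  "nsum f S = the (Finite_Set.fold
     (\<lambda>i acc. case acc of None \<Rightarrow> Some (f i) | Some y \<Rightarrow> Some (f i + y)) None S)"

lemma nsum_step_comm:
  "comp_fun_commute (\<lambda>i acc. case acc of None \<Rightarrow> Some (f i) | Some y \<Rightarrow> Some ((f i :: 'a::ab_semigroup_add) + y))"
  by unfold_locales (auto simp: fun_eq_iff ac_simps split: option.splits)

lemma nsum_fold_not_None:
  assumes "finite S" "S \<noteq> {}"
  shows "Finite_Set.fold
     (\<lambda>i acc. case acc of None \<Rightarrow> Some (f i) | Some y \<Rightarrow> Some ((f i :: 'a::ab_semigroup_add) + y)) None S \<noteq> None"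
proof -
  interpret comp_fun_commute
    "\<lambda>i acc. case acc of None \<Rightarrow> Some (f i) | Some y \<Rightarrow> Some (f i + y)"
    by (rule nsum_step_comm)
  from assms show ?thesis
    by (induction S rule: finite_ne_induct) (auto split: option.splits)
qed

lemma nsum_singleton [simp]: "nsum f {i} = f i"
proof -
  interpret comp_fun_commute
    "\<lambda>i acc. case acc of None \<Rightarrow> Some (f i) | Some y \<Rightarrow> Some (f i + y)"
    by (rule nsum_step_comm)
  show ?thesis by (simp add: nsum_def)
qed

lemma nsum_insert [simp]:
  assumes "finite S" "S \<noteq> {}" "i \<notin> S"
  shows "nsum f (insert i S) = f i + nsum f S"
proof -
  interpret comp_fun_commute
    "\<lambda>i acc. case acc of None \<Rightarrow> Some (f i) | Some y \<Rightarrow> Some (f i + y)"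
    by (rule nsum_step_comm)
  show ?thesis
    using assms nsum_fold_not_None[OF assms(1,2), of f]
    by (auto simp: nsum_def)
qed

text \<open>
  A wrapper type, so that the maximum as addition does not clash with any existing addition on \<open>'b\<close>.
\<close>

datatype 'b bip = Bip (un_bip: 'b)

instantiation bip :: (totally_ordered_monoid) bipotent_semiring_dagger
begin

definition one_bip :: "'a bip" where "1 = Bip 1"

definition times_bip :: "'a bip \<Rightarrow> 'a bip \<Rightarrow> 'a bip" where
  "x * y = Bip (un_bip x * un_bip y)"

definition plus_bip :: "'a bip \<Rightarrow> 'a bip \<Rightarrow> 'a bip" where
  "x + y = Bip (max (un_bip x) (un_bip y))"

instance
proof
  fix a b c :: "'a bip"
  show "a + b + c = a + (b + c)" "a + b = b + a"
    by (simp_all add: plus_bip_def ac_simps)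
  show "a * b * c = a * (b * c)" "a * b = b * a" "1 * a = a"
    by (simp_all add: times_bip_def one_bip_def ac_simps)
  show "a + b = a \<or> a + b = b"
    by (cases a; cases b) (auto simp: plus_bip_def max_def)
  have *: "max x y * z = max (x * z) (y * z)" for x y z :: 'a
    using monoid_mult_left_mono[of x y z] monoid_mult_left_mono[of y x z]
    by (auto simp: max_def mult.commute intro: antisym)
  show "(a + b) * c = a * c + b * c"
    by (simp add: plus_bip_def times_bip_def *)
qed

end

text \<open>
  The formal sum over \<open>S\<close> is represented by the finite nonempty set \<open>S\<close> itself.
\<close>

typedef 'a msums = "{S :: 'a set. finite S \<and> S \<noteq> {}}"
  morphisms msupp formal_sum
  by (rule exI[of _ "{undefined}"]) simp

setup_lifting type_definition_msums

instantiation msums :: (comm_monoid_mult) semiring_dagger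
begin

lift_definition one_msums :: "'a msums" is "{1}" by simp

lift_definition plus_msums :: "'a msums \<Rightarrow> 'a msums \<Rightarrow> 'a msums" is "(\<union>)" by simp

lift_definition times_msums :: "'a msums \<Rightarrow> 'a msums \<Rightarrow> 'a msums"
  is "\<lambda>S T. (\<lambda>(a, b). a * b) ` (S \<times> T)" by auto

instance
proof
  fix a b c :: "'a msums"
  show "a + b + c = a + (b + c)" by transfer auto
  show "a + b = b + a" by transfer auto
  show "a * b * c = a * (b * c)"
    by transfer (force simp: image_iff mult.assoc)
  show "a * b = b * a"
    by transfer (force simp: image_iff mult.commute)
  show "1 * a = a" by transfer force
  show "(a + b) * c = a * c + b * c" by transfer force
qed

end

lift_definition msingle :: "'a \<Rightarrow> 'a msums" is "\<lambda>a. {a}" by simp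

lemma nsum_msingle:
  assumes "finite S" "S \<noteq> {}"
  shows "nsum msingle S = (formal_sum S :: 'a::comm_monoid_mult msums)"
  using assms
proof (induction S rule: finite_ne_induct)
  case (singleton x)
  show ?case by (simp add: msingle_def)
next
  case (insert x F)
  then have "nsum msingle (insert x F) = msingle x + formal_sum F" by simp
  also have "\<dots> = formal_sum (insert x F)"
    using insert.hyps
    by (simp add: msingle_def plus_msums_def formal_sum_inverse)
  finally show ?case .
qed

inductive generated_congruence ::
  "('s::semiring_dagger \<Rightarrow> 's \<Rightarrow> bool) \<Rightarrow> 's \<Rightarrow> 's \<Rightarrow> bool"
  for R where
  base: "R x y \<Longrightarrow> generated_congruence R x y"
| refl: "generated_congruence R x x"
| sym: "generated_congruence R x y \<Longrightarrow> generated_congruence R y x"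
| trans: "generated_congruence R x y \<Longrightarrow> generated_congruence R y z \<Longrightarrow> generated_congruence R x z"
| add: "generated_congruence R x y \<Longrightarrow> generated_congruence R x' y' \<Longrightarrow>
    generated_congruence R (x + x') (y + y')"
| mult: "generated_congruence R x y \<Longrightarrow> generated_congruence R x' y' \<Longrightarrow>
    generated_congruence R (x * x') (y * y')"

text \<open>
  The sums on the right-hand sides run over the index set \<open>S\<close>; terms that coincide are absorbed
  by the idempotent addition of \<open>'a msums\<close>.
\<close>

inductive frobenius_rel :: "'a::comm_monoid_mult msums \<Rightarrow> 'a msums \<Rightarrow> bool" where
  add: "finite S \<Longrightarrow> S \<noteq> {} \<Longrightarrow> 0 < m \<Longrightarrow>
    frobenius_rel (formal_sum S ^ m + c) (nsum (\<lambda>a. msingle (a ^ m)) S + c)"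
| mult: "finite S \<Longrightarrow> S \<noteq> {} \<Longrightarrow> 0 < m \<Longrightarrow>
    frobenius_rel (formal_sum S ^ m * c) (nsum (\<lambda>a. msingle (a ^ m) * c) S)"

abbreviation frobenius_cong :: "'a::comm_monoid_mult msums \<Rightarrow> 'a msums \<Rightarrow> bool" where
  "frobenius_cong \<equiv> generated_congruence frobenius_rel"

quotient_type (overloaded) 'a frob = "'a::comm_monoid_mult msums" / frobenius_cong
  morphisms rep_frob frob_class
  by (rule equivpI)
     (auto intro!: reflpI sympI transpI
       intro: generated_congruence.refl generated_congruence.sym generated_congruence.trans)

instantiation frob :: (comm_monoid_mult) semiring_dagger
begin

lift_definition one_frob :: "'a frob" is 1 .

lift_definition plus_frob :: "'a frob \<Rightarrow> 'a frob \<Rightarrow> 'a frob" is "(+)"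
  by (rule generated_congruence.add)

lift_definition times_frob :: "'a frob \<Rightarrow> 'a frob \<Rightarrow> 'a frob" is "(*)"
  by (rule generated_congruence.mult)

instance
proof
  fix a b c :: "'a frob"
  show "a + b + c = a + (b + c)"
    by transfer (simp add: add.assoc generated_congruence.refl)
  show "a + b = b + a"
    by transfer (simp add: add.commute generated_congruence.refl)
  show "a * b * c = a * (b * c)"
    by transfer (simp add: mult.assoc generated_congruence.refl)
  show "a * b = b * a"
    by transfer (simp add: mult.commute generated_congruence.refl)
  show "1 * a = a"
    by transfer (simp add: generated_congruence.refl)
  show "(a + b) * c = a * c + b * c"
    by transfer (simp add: distrib_right generated_congruence.refl)
qed

end

definition frob_of :: "'a::comm_monoid_mult \<Rightarrow> 'a frob" where
  "frob_of a = frob_class (msingle a)"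

end

theory Submission
  imports Defs
begin

text \<open>
  In a bipotent semiring the relation \<open>a + b = b\<close> is an order compatible with multiplication, so
  \<open>(a + b)\<^sup>m = a\<^sup>m + b\<^sup>m\<close>.  As addition is idempotent, a monoid homomorphism into such a semiring
  extends additively to formal sums, and the extension respects the Frobenius relations; it
  is determined by its values on single elements because these generate additively.
\<close>

lemma nsum_additive:
  assumes "\<And>x y. h (x + y) = h x + h y" "finite S" "S \<noteq> {}"
  shows "h (nsum f S) = nsum (\<lambda>i. h (f i)) S"
  using assms(2,3) by (induction S rule: finite_ne_induct) (simp_all add: assms(1))

lemma add_idem: "a + a = (a::'a::bipotent_semiring_dagger)"
  using bipotent[of a a] by simp

text \<open>Frees \<open>nsum_insert\<close> from its condition \<open>i \<notin> S\<close>: a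
  repeated term is absorbed by idempotence.\<close>

lemma nsum_insert_idem:
  fixes f :: "'i \<Rightarrow> 'a::bipotent_semiring_dagger"
  assumes "finite S" "S \<noteq> {}"
  shows "nsum f (insert i S) = f i + nsum f S"
proof (cases "i \<in> S")
  case True
  then obtain T where T: "S = insert i T" "i \<notin> T" by (meson mk_disjoint_insert)
  show ?thesis
  \<comment> \<open>\<open>nsum_insert\<close> needs a nonempty remainder, so \<open>S = {i}\<close>
    is treated separately.\<close>
  proof (cases "T = {}")
    case True
    then show ?thesis using T by (simp add: add_idem)
  next
    case False
    then show ?thesis using T assms by (simp add: add_idem flip: add.assoc)
  qed
qed (use assms in simp)

lemma nsum_Un_idem:
  fixes f :: "'i \<Rightarrow> 'a::bipotent_semiring_dagger"
  assumes "finite S" "S \<noteq> {}" "finite T" "T \<noteq> {}"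
  shows "nsum f (S \<union> T) = nsum f S + nsum f T"
  using assms(1,2)
  by (induction S rule: finite_ne_induct) (simp_all add: nsum_insert_idem assms(3,4) add.assoc)

lemma power_add_bipotent:
  fixes a b :: "'a::bipotent_semiring_dagger"
  shows "0 < m \<Longrightarrow> (a + b) ^ m = a ^ m + b ^ m"
proof -
  \<comment> \<open>Reading \<open>x + y = y\<close> as x \<le> y, this is monotonicity of
    powers.\<close>
  have le: "x ^ m + y ^ m = y ^ m" if "x + y = y" "0 < m" for x y :: 'a and m
    using that(2)
  proof (induction m rule: nat_induct_non_zero)
    case 1
    then show ?case using that(1) by simp
  next
    case (Suc n)
    \<comment> \<open>The second link of the chain \<open>x ^ Suc n\<close> \<le>
      \<open>x * y ^ n\<close> \<le> \<open>y ^ Suc n\<close>. The first is the induction hypothesis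
      multiplied by \<open>x\<close>.\<close>
    have y: "x * y ^ n + y ^ Suc n = y ^ Suc n"
      using that(1) by (metis distrib_right power_Suc)
    have "x ^ Suc n + y ^ Suc n = x * (x ^ n + y ^ n) + y ^ Suc n"
      by (simp only: distrib_left add.assoc y power_Suc[of x])
    then show ?case by (simp only: Suc.IH y)
  qed
  show "0 < m \<Longrightarrow> (a + b) ^ m = a ^ m + b ^ m"
    using bipotent[of a b] le[of a b m] le[of b a m] by (auto simp: add.commute)
qed

lemma nsum_power_bipotent:
  fixes f :: "'i \<Rightarrow> 'a::bipotent_semiring_dagger"
  assumes "finite S" "S \<noteq> {}" "0 < m"
  shows "nsum f S ^ m = nsum (\<lambda>i. f i ^ m) S"
  \<comment> \<open>By \<open>power_add_bipotent\<close>, raising to the power \<open>m\<close> is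
    itself an additive map.\<close>
  using nsum_additive[of "\<lambda>x. x ^ m" S f] assms by (simp add: power_add_bipotent)

text \<open>A formal sum is a finite nonempty set, so it is built from a single element by adding
  further ones; without a zero, the induction starts there.\<close>

lemma msums_induct [case_names single add]:
  fixes x :: "'a::comm_monoid_mult msums"
  assumes "\<And>a. P (msingle a)" "\<And>a x. P x \<Longrightarrow> P (msingle a + x)"
  shows "P x"
proof -
  have "P (formal_sum S)" if "finite S" "S \<noteq> {}" for S
    using that
  proof (induction S rule: finite_ne_induct)
    case (singleton a)
    then show ?case using assms(1)[of a] by (simp add: msingle_def)
  next
    case (insert a S)
    have "formal_sum (insert a S) = msingle a + formal_sum S"
      using insert.hyps by (simp add: nsum_msingle[symmetric])
    then show ?case using assms(2)[OF insert.IH] by simp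
  qed
  then show ?thesis by (cases x) auto
qed

lemma msingle_times: "msingle a * msingle b = msingle (a * b)"
  by transfer simp

lemma msingle_one: "msingle 1 = 1"
  by transfer simp

definition msums_ext :: "('a::comm_monoid_mult \<Rightarrow> 'b::bipotent_semiring_dagger) \<Rightarrow> 'a msums \<Rightarrow> 'b"
  where "msums_ext f x = nsum f (msupp x)"

lemma msums_ext_formal_sum:
  "finite S \<Longrightarrow> S \<noteq> {} \<Longrightarrow> msums_ext f (formal_sum S) = nsum f S"
  by (simp add: msums_ext_def formal_sum_inverse)

lemma msums_ext_msingle: "msums_ext f (msingle a) = f a"
  by (simp add: msums_ext_def msingle.rep_eq)

text \<open>An element common to both supports contributes once on the left but twice on the right;
  idempotence of the target absorbs the repetition.\<close>

lemma msums_ext_add: "msums_ext f (x + y) = msums_ext f x + msums_ext f y"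
  using msupp[of x] msupp[of y] by (simp add: msums_ext_def plus_msums.rep_eq nsum_Un_idem)

text \<open>By distributivity both sides are additive in each argument, which reduces the claim to
  single elements, where it is multiplicativity of \<open>f\<close>.\<close>

lemma msums_ext_times:
  assumes "monoid_hom f"
  shows "msums_ext f (x * y) = msums_ext f x * msums_ext f y"
proof -
  have *: "msums_ext f (msingle a * y) = msums_ext f (msingle a) * msums_ext f y" for a
    using assms
    by (induction y rule: msums_induct)
       (simp_all add: msums_ext_add msums_ext_msingle msingle_times monoid_hom_def distrib_left)
  show ?thesis
    by (induction x rule: msums_induct) (simp_all add: msums_ext_add * distrib_right)
qed

lemma semiring_dagger_hom_msums_ext:
  assumes "monoid_hom f"
  shows "semiring_dagger_hom (msums_ext f)"
  using assms msums_ext_msingle[of f 1]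
  by (simp add: semiring_dagger_hom_def monoid_hom_def msums_ext_add msums_ext_times msingle_one)

lemma monoid_hom_power: "monoid_hom h \<Longrightarrow> h (x ^ m) = h x ^ m"
  by (induction m) (simp_all add: monoid_hom_def)

text \<open>The kernel of \<open>h\<close> is a congruence containing \<open>R\<close>, hence
  contains the one that \<open>R\<close> generates.\<close>

lemma generated_congruence_hom:
  assumes "semiring_dagger_hom h" "\<And>x y. R x y \<Longrightarrow> h x = h y"
      "generated_congruence R x y"
  shows "h x = h y"
  using assms(3)
  by (induction rule: generated_congruence.induct)
     (use assms(1,2) in \<open>simp_all add: semiring_dagger_hom_def monoid_hom_def\<close>)

lemma frobenius_rel_msums_ext:
  assumes "monoid_hom f" "frobenius_rel x y"
  shows "msums_ext f x = msums_ext f y"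
proof -
  have hom: "monoid_hom (msums_ext f)"
    using semiring_dagger_hom_msums_ext[OF assms(1)] by (simp add: semiring_dagger_hom_def)
  have pow: "msums_ext f (formal_sum S ^ m) = nsum (\<lambda>a. f a ^ m) S"
    if "finite S" "S \<noteq> {}" "0 < m" for S m
    using that by (simp add: monoid_hom_power[OF hom] msums_ext_formal_sum nsum_power_bipotent)
  show ?thesis
    using assms(2)
  proof cases
    case (add S m c)
    then show ?thesis
      by (simp add: msums_ext_add pow nsum_additive[of "msums_ext f"] msums_ext_msingle
          monoid_hom_power[OF assms(1)])
  next
    case (mult S m c)
    \<comment> \<open>Multiplication by \<open>z\<close> is additive, so it passes into the
      sum.\<close>
    have "nsum (\<lambda>a. f a ^ m) S * z = nsum (\<lambda>a. f a ^ m * z) S" for z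
      using mult by (intro nsum_additive) (simp_all add: distrib_right)
    then show ?thesis
      using mult
      by (simp add: msums_ext_times[OF assms(1)] msums_ext_add pow
          nsum_additive[of "msums_ext f"] msums_ext_msingle monoid_hom_power[OF assms(1)])
  qed
qed

lemma frobenius_cong_msums_ext:
  assumes "monoid_hom f" "frobenius_cong x y"
  shows "msums_ext f x = msums_ext f y"
  using generated_congruence_hom[OF semiring_dagger_hom_msums_ext] assms frobenius_rel_msums_ext
  by blast

text \<open>The value is read off a chosen representative; for a monoid homomorphism
  \<open>f\<close>, \<open>frob_ext_frob_class\<close> shows that the choice is immaterial.\<close>

definition frob_ext :: "('a::comm_monoid_mult \<Rightarrow> 'b::bipotent_semiring_dagger) \<Rightarrow> 'a frob \<Rightarrow> 'b"
  where "frob_ext f x = msums_ext f (rep_frob x)"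

lemma frob_ext_frob_class:
  assumes "monoid_hom f"
  shows "frob_ext f (frob_class x) = msums_ext f x"
  unfolding frob_ext_def
  by (intro frobenius_cong_msums_ext[OF assms] Quotient3_rep_abs[OF Quotient3_frob]
      generated_congruence.refl)

lemma frob_class_cases: obtains x where "y = frob_class x"
  by (metis Quotient3_frob Quotient3_abs_rep)

lemma semiring_dagger_hom_frob_ext:
  assumes "monoid_hom f"
  shows "semiring_dagger_hom (frob_ext f)"
proof -
  have "frob_ext f 1 = 1"
    using semiring_dagger_hom_msums_ext[OF assms]
    by (simp add: one_frob_def frob_ext_frob_class[OF assms] semiring_dagger_hom_def monoid_hom_def)
  moreover have "frob_ext f (x * y) = frob_ext f x * frob_ext f y"
    "frob_ext f (x + y) = frob_ext f x + frob_ext f y" for x y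
    by (cases x rule: frob_class_cases; cases y rule: frob_class_cases;
        simp add: times_frob.abs_eq plus_frob.abs_eq frob_ext_frob_class assms
          msums_ext_add msums_ext_times)+
  ultimately show ?thesis by (simp add: semiring_dagger_hom_def monoid_hom_def)
qed

text \<open>Gives uniqueness of the factorization: every class is a sum of classes of single
  elements, so agreement on those spreads by additivity.\<close>

lemma frob_hom_eqI:
  fixes g h :: "'a::comm_monoid_mult frob \<Rightarrow> 'b::semiring_dagger"
  assumes "semiring_dagger_hom g" "semiring_dagger_hom h" "g \<circ> frob_of = h \<circ> frob_of"
  shows "g = h"
proof
  fix y :: "'a frob"
  obtain x where y: "y = frob_class x" by (rule frob_class_cases)
  have "g (frob_class x) = h (frob_class x)"
  proof (induction x rule: msums_induct)
    case (single a)
    then show ?case using assms(3) by (simp add: fun_eq_iff frob_of_def)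
  next
    case (add a x)
    then show ?case
      using assms by (simp add: semiring_dagger_hom_def fun_eq_iff frob_of_def
          flip: plus_frob.abs_eq)
  qed
  then show "g y = h y" by (simp add: y)
qed

theorem proposition3p13:
  fixes \<phi> :: "'a::comm_monoid_mult \<Rightarrow> 'b::totally_ordered_monoid"
  assumes "monoid_hom \<phi>"
  shows "\<exists>\<phi>hat :: 'a frob \<Rightarrow> 'b bip.
    semiring_dagger_hom \<phi>hat \<and>
    (\<forall>S. finite S \<and> S \<noteq> {} \<longrightarrow>
      \<phi>hat (frob_class (formal_sum S)) = nsum (\<lambda>a. Bip (\<phi> a)) S) \<and>
    \<phi>hat \<circ> frob_of = Bip \<circ> \<phi> \<and>
    (\<forall>\<psi> :: 'a frob \<Rightarrow> 'b bip.
      semiring_dagger_hom \<psi> \<and> \<psi> \<circ> frob_of = Bip \<circ> \<phi> \<longrightarrow> \<psi> = \<phi>hat)"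
proof (intro exI conjI allI impI)
  let ?f = "\<lambda>a. Bip (\<phi> a)" and ?h = "frob_ext (\<lambda>a. Bip (\<phi> a))"
  \<comment> \<open>\<open>Bip\<close> leaves product and unit unchanged; the order enters only
    through the addition of the target.\<close>
  have f: "monoid_hom ?f"
    using assms by (simp add: monoid_hom_def one_bip_def times_bip_def)
  show hom: "semiring_dagger_hom ?h"
    by (rule semiring_dagger_hom_frob_ext[OF f])
  show "?h (frob_class (formal_sum S)) = nsum ?f S" if "finite S \<and> S \<noteq> {}" for S
    using that by (simp add: frob_ext_frob_class[OF f] msums_ext_formal_sum)
  show of: "?h \<circ> frob_of = Bip \<circ> \<phi>"
    by (simp add: fun_eq_iff frob_of_def frob_ext_frob_class[OF f] msums_ext_msingle)
  show "\<psi> = ?h" if "semiring_dagger_hom \<psi> \<and> \<psi> \<circ> frob_of = Bip \<circ> \<phi>" for \<psi>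
    using that hom of by (intro frob_hom_eqI) simp_all
qed

end
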